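(* Let $A$ be a commutative ring with unit and let $f,g\in\mathcal{A}=1+XA[[X]]$. Then $$\mathcal{D}(f\star g)=-\mathcal{D}(f)\odot\mathcal{D}(g).$$
   Context: $\mathcal{D}(f)=f'/f\in A[[X]]$ is the logarithmic derivative. The Hadamard multiplication of $u=\sum_{n\ge0}u_nX^n$ and $v=\sum_{n\ge0}v_nX^n$ in $A[[X]]$ is $u\odot v=\sum_{n\ge0}u_nv_nX^n$. Eñe product: for $n\ge1$, let $Q_n\in\mathbb{Z}[X_1,\dots,X_n,Y_1,\dots,Y_n]$ be the unique polynomial such that in $\mathbb{Z}[x_1,\dots,x_n,y_1,\dots,y_n]$ the $n$-th elementary symmetric polynomial of the $n^2$ products $x_iy_j$ equals $Q_n(e_1(x),\dots,e_n(x),e_1(y),\dots,e_n(y))$, where $e_k$ are the elementary symmetric polynomials. For $f=1+\sum_{n\ge1}a_nX^n$ and $g=1+\sum_{n\ge1}b_nX^n$ in $\mathcal{A}$, $f\star g=1+\sum_{n\ge1}c_nX^n$ with $c_n=(-1)^nQ_n(a_1,\dots,a_n,b_1,\dots,b_n)$. *)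

theory Defs
  imports
    "HOL-Library.Poly_Mapping"
    "HOL-Computational_Algebra.Formal_Power_Series"
begin

(* Integer polynomials in variables indexed by 'v: finitely supported maps from
   monomials (exponent vectors) to coefficients.  The ring operations are the
   convolution ones provided by Poly_Mapping. *)
type_synonym 'v int_mpoly = "('v \<Rightarrow>\<^sub>0 nat) \<Rightarrow>\<^sub>0 int"

definition Var :: "'v \<Rightarrow> 'v int_mpoly" where
  "Var v = Poly_Mapping.single (Poly_Mapping.single v 1) 1"

definition indets :: "'v int_mpoly \<Rightarrow> 'v set" where
  "indets p = (\<Union>m\<in>Poly_Mapping.keys p. Poly_Mapping.keys m)"

definition eval_mpoly :: "('v \<Rightarrow> 'a::comm_ring_1) \<Rightarrow> 'v int_mpoly \<Rightarrow> 'a" where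
  "eval_mpoly h p = (\<Sum>m\<in>Poly_Mapping.keys p. of_int (Poly_Mapping.lookup p m) *
     (\<Prod>v\<in>Poly_Mapping.keys m. h v ^ Poly_Mapping.lookup m v))"

(* The k-th elementary symmetric function of the finite family (z i), i in I. *)
definition elem_sym :: "nat \<Rightarrow> 'i set \<Rightarrow> ('i \<Rightarrow> 'a::comm_ring_1) \<Rightarrow> 'a" where
  "elem_sym k I z = (\<Sum>S | S \<subseteq> I \<and> card S = k. \<Prod>i\<in>S. z i)"

(* Both Z[X_1,...,X_n,Y_1,...,Y_n] and Z[x_1,...,x_n,y_1,...,y_n] are realised inside
   (nat + nat) int_mpoly: Inl i is the i-th variable of the first group, Inr j the
   j-th variable of the second group, with 1 <= i, j <= n.  The second condition
   says Q(e_1(x),...,e_n(x),e_1(y),...,e_n(y)) = e_n(x_i y_j : 1 <= i, j <= n). *)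
definition is_ene_poly :: "nat \<Rightarrow> (nat + nat) int_mpoly \<Rightarrow> bool" where
  "is_ene_poly n Q \<longleftrightarrow>
     indets Q \<subseteq> Inl ` {1..n} \<union> Inr ` {1..n} \<and>
     eval_mpoly
       (case_sum (\<lambda>k. elem_sym k {1..n} (\<lambda>i. Var (Inl i)))
                 (\<lambda>k. elem_sym k {1..n} (\<lambda>j. Var (Inr j)))) Q
     = (elem_sym n ({1..n} \<times> {1..n}) (\<lambda>(i, j). Var (Inl i) * Var (Inr j))
         :: (nat + nat) int_mpoly)"

definition ene_poly :: "nat \<Rightarrow> (nat + nat) int_mpoly" where
  "ene_poly n = (THE Q. is_ene_poly n Q)"

(* Meant for f and g with constant term 1; only their coefficients of index 1..n
   enter the n-th coefficient. *)
definition ene_prod :: "'a::comm_ring_1 fps \<Rightarrow> 'a fps \<Rightarrow> 'a fps" (infixl \<open>\<star>\<close> 70) where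
  "f \<star> g = Abs_fps (\<lambda>n. if n = 0 then 1
     else (- 1) ^ n * eval_mpoly (case_sum (fps_nth f) (fps_nth g)) (ene_poly n))"

(* f'/f.  Division of power series in the library needs an inverse operation on the
   coefficients, which an arbitrary commutative ring lacks; fps_right_inverse f 1 is
   the inverse of f when f has constant term 1 (see log_deriv_mult). *)
definition log_deriv :: "'a::comm_ring_1 fps \<Rightarrow> 'a fps" where
  "log_deriv f = fps_deriv f * fps_right_inverse f 1"

lemma log_deriv_mult:
  assumes "fps_nth f 0 = 1"
  shows "log_deriv f * f = fps_deriv f"
proof -
  have "f * fps_right_inverse f 1 = 1"
    using assms by (intro fps_right_inverse) simp
  then show ?thesis
    unfolding log_deriv_def by (simp add: mult.assoc mult.commute[of "fps_right_inverse f 1"])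
qed

definition hadamard :: "'a::comm_ring_1 fps \<Rightarrow> 'a fps \<Rightarrow> 'a fps" (infixl \<open>\<odot>\<close> 70) where
  "u \<odot> v = Abs_fps (\<lambda>n. fps_nth u n * fps_nth v n)"

end

theory Submission
  imports
    Defs
    "Jordan_Normal_Form.Determinant"
    "HOL-Library.Countable"
    "HOL-Library.Infinite_Set"
    "HOL-Computational_Algebra.Fundamental_Theorem_Algebra"
    "HOL-Computational_Algebra.Polynomial_FPS"
begin

no_notation vec_index (infixl "$" 100)
no_notation module.smult (infixl "\<odot>\<index>" 70)
unbundle fps_syntax

text \<open>
  If \<open>f = \<Prod>i. (1 + x\<^sub>i X)\<close> and \<open>g = \<Prod>j. (1 + y\<^sub>j X)\<close>, then \<open>f \<star> g = \<Prod>i j. (1 - x\<^sub>i y\<^sub>j X)\<close> and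
  the \<open>n\<close>-th coefficient of the logarithmic derivative of such a product is a signed power sum of
  degree \<open>n + 1\<close>; power sums of the \<open>x\<^sub>i y\<^sub>j\<close> are products of power sums. Over \<open>\<complex>\<close>,
  every series with constant term 1 agrees with such a product up to any prescribed degree, and
  in characteristic 0 the logarithmic derivative determines the series. Each
  coefficient of the claim is an identity between integer polynomials in the coefficients of \<open>f\<close>
  and \<open>g\<close>; since an integer polynomial is determined by its complex values, the identity
  passes from \<open>\<complex>\<close> to the universal case and hence to every commutative ring.

  The polynomials \<open>Q\<^sub>n\<close> are unique because every complex vector consists of the elementary symmetric
  functions of some family. They exist because \<open>\<Prod>i. G(x\<^sub>i)\<close> is the determinant of \<open>G(C)\<close> for the
  companion matrix \<open>C\<close> of \<open>\<Prod>i. (t - x\<^sub>i)\<close>, whose entries are polynomials in the elementary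
  symmetric functions.
\<close>

subsection \<open>Evaluation of integer polynomials\<close>

definition eval_monom :: "('v \<Rightarrow> 'a::comm_ring_1) \<Rightarrow> ('v \<Rightarrow>\<^sub>0 nat) \<Rightarrow> 'a" where
  "eval_monom h m = (\<Prod>v\<in>Poly_Mapping.keys m. h v ^ Poly_Mapping.lookup m v)"

lemma eval_monom_superset:
  assumes "finite V" and "Poly_Mapping.keys m \<subseteq> V"
  shows "eval_monom h m = (\<Prod>v\<in>V. h v ^ Poly_Mapping.lookup m v)"
  unfolding eval_monom_def
  using assms by (intro prod.mono_neutral_left) (auto simp: in_keys_iff)

lemma eval_monom_add: "eval_monom h (m + n) = eval_monom h m * eval_monom h n"
proof -
  let ?V = "Poly_Mapping.keys m \<union> Poly_Mapping.keys n"
  have "Poly_Mapping.keys (m + n) \<subseteq> ?V"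
    by (rule Poly_Mapping.keys_add)
  then show ?thesis
    by (simp add: eval_monom_superset[of ?V] lookup_add power_add prod.distrib)
qed

lemma eval_monom_cong:
  "(\<And>v. v \<in> Poly_Mapping.keys m \<Longrightarrow> h v = h' v) \<Longrightarrow> eval_monom h m = eval_monom h' m"
  unfolding eval_monom_def by (intro prod.cong) auto

lemma eval_mpoly_superset:
  assumes "finite K" and "Poly_Mapping.keys p \<subseteq> K"
  shows "eval_mpoly h p = (\<Sum>m\<in>K. of_int (Poly_Mapping.lookup p m) * eval_monom h m)"
  unfolding eval_mpoly_def eval_monom_def
  using assms by (intro sum.mono_neutral_left) (auto simp: in_keys_iff)

lemma eval_mpoly_add: "eval_mpoly h (p + q) = eval_mpoly h p + eval_mpoly h q"
proof -
  let ?K = "Poly_Mapping.keys p \<union> Poly_Mapping.keys q"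
  have "Poly_Mapping.keys (p + q) \<subseteq> ?K"
    by (rule Poly_Mapping.keys_add)
  then show ?thesis
    by (simp add: eval_mpoly_superset[of ?K] lookup_add distrib_right sum.distrib)
qed

lemma eval_mpoly_0 [simp]: "eval_mpoly h 0 = 0"
  by (simp add: eval_mpoly_def)

lemma eval_mpoly_sum: "eval_mpoly h (sum p I) = (\<Sum>i\<in>I. eval_mpoly h (p i))"
  by (induction I rule: infinite_finite_induct) (simp_all add: eval_mpoly_add)

lemma eval_mpoly_single:
  "eval_mpoly h (Poly_Mapping.single m c) = of_int c * eval_monom h m"
  by (subst eval_mpoly_superset[of "{m}"]) simp_all

lemma poly_mapping_sum_singles:
  "p = (\<Sum>m\<in>Poly_Mapping.keys p. Poly_Mapping.single m (Poly_Mapping.lookup p m))"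
  by (intro poly_mapping_eqI) (simp add: lookup_sum lookup_single when_def in_keys_iff)

text \<open>Both factors are split into single terms, where multiplicativity is
  \<open>eval_monom_add\<close>.\<close>

lemma eval_mpoly_mult: "eval_mpoly h (p * q) = eval_mpoly h p * eval_mpoly h q"
proof -
  let ?s = "\<lambda>p m. Poly_Mapping.single m (Poly_Mapping.lookup p m)"
  have "p * q = (\<Sum>m\<in>Poly_Mapping.keys p. ?s p m) * (\<Sum>n\<in>Poly_Mapping.keys q. ?s q n)"
    using poly_mapping_sum_singles[of p] poly_mapping_sum_singles[of q] by simp
  also have "eval_mpoly h \<dots> = (\<Sum>m\<in>Poly_Mapping.keys p. \<Sum>n\<in>Poly_Mapping.keys q.
      eval_mpoly h (?s p m) * eval_mpoly h (?s q n))"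
    by (simp add: sum_product eval_mpoly_sum mult_single eval_mpoly_single eval_monom_add mult_ac)
  also have "\<dots> = eval_mpoly h (\<Sum>m\<in>Poly_Mapping.keys p. ?s p m)
      * eval_mpoly h (\<Sum>n\<in>Poly_Mapping.keys q. ?s q n)"
    by (simp add: sum_product eval_mpoly_sum)
  finally show ?thesis
    using poly_mapping_sum_singles[of p] poly_mapping_sum_singles[of q] by simp
qed

lemma eval_mpoly_1: "eval_mpoly h 1 = 1"
  by (subst single_one[symmetric], subst eval_mpoly_single) (simp add: eval_monom_def)

lemma eval_mpoly_hom: "comm_ring_hom (eval_mpoly h)"
  by unfold_locales (simp_all add: eval_mpoly_add eval_mpoly_mult eval_mpoly_1)

lemma eval_mpoly_Var [simp]: "eval_mpoly h (Var v) = h v"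
  by (simp add: Var_def eval_mpoly_single eval_monom_def)

lemma (in comm_ring_hom) hom_eval_mpoly: "hom (eval_mpoly h p) = eval_mpoly (\<lambda>v. hom (h v)) p"
  by (simp add: eval_mpoly_def hom_distribs)

lemma eval_mpoly_cong:
  assumes "\<And>v. v \<in> indets p \<Longrightarrow> h v = h' v"
  shows "eval_mpoly h p = eval_mpoly h' p"
proof -
  have "eval_monom h m = eval_monom h' m" if "m \<in> Poly_Mapping.keys p" for m
    using assms that by (intro eval_monom_cong) (auto simp: indets_def)
  then show ?thesis
    by (simp add: eval_mpoly_superset[of "Poly_Mapping.keys p"])
qed

lemma eval_monom_power: "eval_monom (\<lambda>v. h v ^ t) m = eval_monom h m ^ t"
  by (simp add: eval_monom_def prod_power_distrib power_mult[symmetric] mult.commute)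

lemma indets_Var: "indets (Var v) = {v}"
  by (simp add: indets_def Var_def)

lemma indets_1: "indets 1 = {}"
  by (simp add: indets_def)

lemma indets_diff: "indets (p - q) \<subseteq> indets p \<union> indets q"
  unfolding indets_def using keys_diff[of p q] by blast

lemma indets_mult: "indets (p * q) \<subseteq> indets p \<union> indets q"
proof
  fix v assume "v \<in> indets (p * q)"
  then obtain m where m: "m \<in> Poly_Mapping.keys (p * q)" "v \<in> Poly_Mapping.keys m"
    by (auto simp: indets_def)
  then obtain a b where ab: "m = a + b" "a \<in> Poly_Mapping.keys p" "b \<in> Poly_Mapping.keys q"
    using keys_mult[of p q] by auto
  then have "v \<in> Poly_Mapping.keys a \<union> Poly_Mapping.keys b"
    using m keys_add[of a b] by auto
  then show "v \<in> indets p \<union> indets q"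
    using ab by (auto simp: indets_def)
qed

section \<open>Separating integer polynomials by their values\<close>

lemma inj_primes:
  obtains pr :: "'v::countable \<Rightarrow> nat" where "inj pr" and "\<And>v. prime (pr v)"
proof (rule that)
  let ?P = "{p::nat. prime p}"
  have inf: "infinite ?P"
    by (rule primes_infinite)
  have "strict_mono (enumerate ?P)"
    using inf by (rule strict_mono_enumerate)
  then show "inj (\<lambda>v::'v. enumerate ?P (to_nat v))"
    by (auto intro!: injI simp: strict_mono_eq)
  show "prime (enumerate ?P (to_nat v))" for v :: 'v
    using enumerate_in_set[OF inf] by simp
qed

text \<open>Unique factorization: the exponent of \<open>v\<close> is the multiplicity of the prime
  \<open>pr v\<close> in the value.\<close>

lemma inj_eval_monom_primes:
  fixes pr :: "'v \<Rightarrow> nat"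
  assumes "inj pr" and "\<And>v. prime (pr v)"
  shows "inj (eval_monom (\<lambda>v. int (pr v)))"
proof (rule injI)
  have mult: "multiplicity (pr v) (\<Prod>w\<in>Poly_Mapping.keys m. pr w ^ Poly_Mapping.lookup m w)
      = Poly_Mapping.lookup m v" for m v
  proof -
    have eq: "(\<Prod>w\<in>Poly_Mapping.keys m. pr w ^ Poly_Mapping.lookup m w)
        = (\<Prod>q\<in>pr ` Poly_Mapping.keys m. q ^ Poly_Mapping.lookup m (inv_into UNIV pr q))"
      using assms(1) by (subst prod.reindex) (auto intro: inj_on_subset)
    show ?thesis
      unfolding eq using assms(1) by (subst multiplicity_prod_prime_powers)
        (auto simp: assms(2) in_keys_iff inj_image_mem_iff)
  qed
  fix m n assume "eval_monom (\<lambda>v. int (pr v)) m = eval_monom (\<lambda>v. int (pr v)) n"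
  then have "(\<Prod>w\<in>Poly_Mapping.keys m. pr w ^ Poly_Mapping.lookup m w)
      = (\<Prod>w\<in>Poly_Mapping.keys n. pr w ^ Poly_Mapping.lookup n w)"
    unfolding eval_monom_def of_nat_power[symmetric] of_nat_prod[symmetric] of_nat_eq_iff .
  then show "m = n"
    using mult by (metis poly_mapping_eqI)
qed

text \<open>Evaluating at the \<open>t\<close>-th powers of distinct primes turns the monomials into
  \<open>t\<close>-th powers of distinct integers, so a polynomial in one variable can single out
  each coefficient.\<close>

lemma int_mpoly_eq_0I:
  fixes p :: "'v::countable int_mpoly"
  assumes "\<And>h :: 'v \<Rightarrow> int. eval_mpoly h p = 0"
  shows "p = 0"
proof -
  let ?K = "Poly_Mapping.keys p"
  obtain pr :: "'v \<Rightarrow> nat" where pr: "inj pr" "\<And>v. prime (pr v)"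
    using inj_primes by blast
  define M where "M = eval_monom (\<lambda>v. int (pr v))"
  have inj: "inj M"
    unfolding M_def using pr by (rule inj_eval_monom_primes)
  have pow: "(\<Sum>m\<in>?K. Poly_Mapping.lookup p m * M m ^ t) = 0" for t
    using assms[of "\<lambda>v. int (pr v) ^ t"]
    by (simp add: eval_mpoly_superset[of ?K] eval_monom_power M_def)
  have poly: "(\<Sum>m\<in>?K. Poly_Mapping.lookup p m * poly q (M m)) = 0" for q
  proof -
    have "(\<Sum>m\<in>?K. Poly_Mapping.lookup p m * poly q (M m))
        = (\<Sum>i\<le>degree q. coeff q i * (\<Sum>m\<in>?K. Poly_Mapping.lookup p m * M m ^ i))"
      by (simp add: poly_altdef sum_distrib_left mult_ac) (rule sum.swap)
    then show ?thesis
      by (simp add: pow)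
  qed
  have "?K = {}"
  proof (rule ccontr)
    assume "?K \<noteq> {}"
    then obtain m where m: "m \<in> ?K" by blast
    \<comment> \<open>\<open>q\<close> vanishes at \<open>M n\<close> for every other key
      \<open>n\<close> but, as \<open>M\<close> is injective, not at \<open>M m\<close>; a single
      nonzero term survives.\<close>
    define q where "q = (\<Prod>n\<in>?K - {m}. [:- M n, 1:])"
    have "(\<Sum>n\<in>?K. Poly_Mapping.lookup p n * poly q (M n))
        = (\<Sum>n\<in>{m}. Poly_Mapping.lookup p n * poly q (M n))"
      using m by (intro sum.mono_neutral_right) (auto simp: q_def poly_prod)
    moreover have "poly q (M m) \<noteq> 0"
      using inj by (auto simp: q_def poly_prod inj_eq)
    ultimately show False
      using poly[of q] m by (simp add: in_keys_iff)
  qed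
  then show ?thesis
    by simp
qed

text \<open>Integer assignments embed into \<open>'a\<close> by \<open>of_int\<close>, injective in
  characteristic 0, so equal values over \<open>'a\<close> force equal values over the
  integers.\<close>

lemma int_mpoly_eqI:
  fixes p q :: "'v::countable int_mpoly"
  assumes "\<And>h :: 'v \<Rightarrow> 'a::{comm_ring_1,ring_char_0}. eval_mpoly h p = eval_mpoly h q"
  shows "p = q"
proof -
  have "eval_mpoly h (p - q) = 0" for h :: "'v \<Rightarrow> int"
  proof -
    interpret E: comm_ring_hom "eval_mpoly (\<lambda>v. of_int (h v) :: 'a)"
      by (rule eval_mpoly_hom)
    have "comm_ring_hom (of_int :: int \<Rightarrow> 'a)"
      by unfold_locales simp_all
    then have "(of_int (eval_mpoly h (p - q)) :: 'a) = eval_mpoly (\<lambda>v. of_int (h v)) (p - q)"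
      by (rule comm_ring_hom.hom_eval_mpoly)
    also have "\<dots> = eval_mpoly (\<lambda>v. of_int (h v)) p - eval_mpoly (\<lambda>v. of_int (h v)) q"
      by (rule E.hom_minus)
    also have "\<dots> = 0"
      using assms by simp
    finally show ?thesis
      by simp
  qed
  then have "p - q = 0"
    by (rule int_mpoly_eq_0I)
  then show ?thesis
    by simp
qed

subsection \<open>Elementary symmetric functions\<close>

lemma (in comm_ring_hom) hom_elem_sym: "hom (elem_sym k I z) = elem_sym k I (\<lambda>i. hom (z i))"
  by (simp add: elem_sym_def hom_distribs)

lemma elem_sym_gt_card:
  assumes "finite I" and "card I < k"
  shows "elem_sym k I z = 0"
proof -
  have "{S. S \<subseteq> I \<and> card S = k} = {}"
    using card_mono[OF assms(1)] assms(2) by (auto simp: not_less[symmetric])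
  then show ?thesis
    unfolding elem_sym_def by (metis sum.empty)
qed

lemma elem_sym_scale: "elem_sym k I (\<lambda>i. c * z i) = c ^ k * elem_sym k I z"
  by (simp add: elem_sym_def prod.distrib sum_distrib_left)

lemma fps_const_hom: "comm_ring_hom (fps_const :: 'a::comm_ring_1 \<Rightarrow> 'a fps)"
  by unfold_locales simp_all

text \<open>In the expanded product, the set S of factors contributing their linear term yields
  degree \<open>card S\<close>.\<close>

lemma fps_nth_prod_linear:
  fixes z :: "'i \<Rightarrow> 'a::comm_ring_1"
  assumes "finite I"
  shows "fps_nth (\<Prod>i\<in>I. 1 + fps_const (z i) * fps_X) k = elem_sym k I z"
proof -
  interpret C: comm_ring_hom "fps_const :: 'a \<Rightarrow> 'a fps"
    by (rule fps_const_hom)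
  have "(\<Prod>i\<in>I. 1 + fps_const (z i) * fps_X) = (\<Sum>S\<in>Pow I. fps_const (\<Prod>i\<in>S. z i) * fps_X ^ card S)"
    using prod_add[OF assms, of "\<lambda>i. fps_const (z i) * fps_X" "\<lambda>_. 1"]
    by (simp add: prod.distrib add.commute C.hom_prod)
  then have "fps_nth (\<Prod>i\<in>I. 1 + fps_const (z i) * fps_X) k
      = (\<Sum>S\<in>Pow I. if card S = k then \<Prod>i\<in>S. z i else 0)"
    by (simp add: fps_sum_nth if_distrib cong: if_cong) (auto intro!: sum.cong)
  also have "\<dots> = elem_sym k I z"
    unfolding elem_sym_def using assms by (subst sum.inter_filter[symmetric]) auto
  finally show ?thesis .
qed

lemma prod_const_poly: "(\<Prod>i\<in>I. [:c i:]) = [:\<Prod>i\<in>I. c i:]"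
  by (induction I rule: infinite_finite_induct) (simp_all add: one_pCons mult.commute)

text \<open>Vieta's formulas: S collects the factors contributing \<open>- z i\<close>, leaving
  degree \<open>card I - card S\<close>. The bound on \<open>k\<close> keeps the truncated
  subtractions exact.\<close>

lemma coeff_prod_linear:
  assumes "finite I" and "k \<le> card I"
  shows "coeff (\<Prod>i\<in>I. [:- z i, 1:]) k = (- 1) ^ (card I - k) * elem_sym (card I - k) I z"
proof -
  have "(\<Prod>i\<in>I. [:- z i, 1:]) = (\<Prod>i\<in>I. [:- z i:] + monom 1 1)"
    by (intro prod.cong) (simp_all add: monom_Suc)
  also have "\<dots> = (\<Sum>S\<in>Pow I. (\<Prod>i\<in>S. [:- z i:]) * (\<Prod>i\<in>I - S. monom 1 1))"
    by (rule prod_add) fact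
  also have "\<dots> = (\<Sum>S\<in>Pow I. monom (\<Prod>i\<in>S. - z i) (card I - card S))"
  proof (rule sum.cong[OF refl])
    fix S assume "S \<in> Pow I"
    then have "card (I - S) = card I - card S"
      using assms(1) by (auto intro: card_Diff_subset finite_subset)
    then show "(\<Prod>i\<in>S. [:- z i:]) * (\<Prod>i\<in>I - S. monom 1 1)
        = monom (\<Prod>i\<in>S. - z i) (card I - card S)"
      by (simp add: prod_const_poly monom_power smult_monom)
  qed
  finally have "coeff (\<Prod>i\<in>I. [:- z i, 1:]) k
      = (\<Sum>S\<in>Pow I. if card I - card S = k then \<Prod>i\<in>S. - z i else 0)"
    by (simp add: coeff_sum)
  also have "\<dots> = (\<Sum>S | S \<in> Pow I \<and> card I - card S = k. \<Prod>i\<in>S. - z i)"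
    using assms by (subst sum.inter_filter) auto
  also have "{S. S \<in> Pow I \<and> card I - card S = k} = {S. S \<subseteq> I \<and> card S = card I - k}"
  proof -
    have "card I - card S = k \<longleftrightarrow> card S = card I - k" if "S \<subseteq> I" for S
      using card_mono[OF assms(1) that] assms(2) by linarith
    then show ?thesis by auto
  qed
  finally show ?thesis
    by (simp add: elem_sym_def prod_uminus sum_distrib_left)
qed

subsection \<open>Norms from a companion matrix\<close>

text \<open>Being a polynomial expression in given elements is treated as membership in such a set,
  so closure replaces explicit formulas.\<close>

locale unital_subring =
  fixes S :: "'a::comm_ring_1 set"
  assumes one_closed: "1 \<in> S"
    and diff_closed: "x \<in> S \<Longrightarrow> y \<in> S \<Longrightarrow> x - y \<in> S"
    and mult_closed: "x \<in> S \<Longrightarrow> y \<in> S \<Longrightarrow> x * y \<in> S"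
begin

lemma zero_closed: "0 \<in> S"
  using diff_closed[OF one_closed one_closed] by simp

lemma uminus_closed: "x \<in> S \<Longrightarrow> - x \<in> S"
  using diff_closed[OF zero_closed] by simp

lemma add_closed: "x \<in> S \<Longrightarrow> y \<in> S \<Longrightarrow> x + y \<in> S"
  using diff_closed[OF _ uminus_closed] by fastforce

lemma sum_closed: "(\<And>i. i \<in> I \<Longrightarrow> f i \<in> S) \<Longrightarrow> sum f I \<in> S"
  by (induction I rule: infinite_finite_induct) (auto intro: zero_closed add_closed)

lemma prod_closed: "(\<And>i. i \<in> I \<Longrightarrow> f i \<in> S) \<Longrightarrow> prod f I \<in> S"
  by (induction I rule: infinite_finite_induct) (auto intro: one_closed mult_closed)

lemma power_closed: "x \<in> S \<Longrightarrow> x ^ n \<in> S"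
  by (induction n) (auto intro: one_closed mult_closed)

lemma det_closed:
  assumes "A \<in> carrier_mat n n" and "\<And>i j. i < n \<Longrightarrow> j < n \<Longrightarrow> A $$ (i, j) \<in> S"
  shows "det A \<in> S"
  unfolding det_def'[OF assms(1)]
proof (rule sum_closed)
  fix p assume "p \<in> {p. p permutes {0..<n}}"
  then have "p i < n" if "i < n" for i
    using that permutes_in_image[of p "{0..<n}" i] by auto
  then have "(\<Prod>i = 0..<n. A $$ (i, p i)) \<in> S"
    by (intro prod_closed assms(2)) auto
  moreover have "signof p \<in> S"
    by (simp add: sign_def one_closed uminus_closed)
  ultimately show "signof p * (\<Prod>i = 0..<n. A $$ (i, p i)) \<in> S"
    by (rule mult_closed[rotated])
qed

end

section \<open>Polynomials in a matrix by Horner's scheme, constant term first\<close>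

primrec horner_mat :: "nat \<Rightarrow> 'a::comm_ring_1 list \<Rightarrow> 'a mat \<Rightarrow> 'a mat" where
  "horner_mat n [] A = 0\<^sub>m n n"
| "horner_mat n (c # cs) A = c \<cdot>\<^sub>m 1\<^sub>m n + A * horner_mat n cs A"

lemma horner_mat_carrier [simp]:
  "A \<in> carrier_mat n n \<Longrightarrow> horner_mat n cs A \<in> carrier_mat n n"
  by (induction cs) auto

text \<open>Scalar matrices commute with \<open>V\<close>, so each Horner step inherits the
  relation; no inverse of \<open>V\<close> is involved.\<close>

lemma horner_mat_intertwine:
  assumes C: "C \<in> carrier_mat n n" and B: "B \<in> carrier_mat n n" and V: "V \<in> carrier_mat n n"
    and eq: "C * V = V * B"
  shows "horner_mat n cs C * V = V * horner_mat n cs B"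
proof (induction cs)
  case Nil
  then show ?case
    using V by simp
next
  case (Cons c cs)
  let ?C = "horner_mat n cs C" and ?B = "horner_mat n cs B"
  have [simp]: "?C \<in> carrier_mat n n" "?B \<in> carrier_mat n n"
    using C B by simp_all
  have "(C * ?C) * V = C * (V * ?B)"
    using Cons.IH C V by (simp add: assoc_mult_mat[of _ n n _ n _ n])
  also have "\<dots> = (V * B) * ?B"
    using C V B by (simp add: assoc_mult_mat[of _ n n _ n _ n, symmetric] eq)
  also have "\<dots> = V * (B * ?B)"
    using V B by (simp add: assoc_mult_mat[of _ n n _ n _ n])
  finally have step: "(C * ?C) * V = V * (B * ?B)" .
  have "horner_mat n (c # cs) C * V = (c \<cdot>\<^sub>m 1\<^sub>m n) * V + (C * ?C) * V"
    using C V by (simp add: add_mult_distrib_mat[of _ n n _ _ n])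
  also have "(c \<cdot>\<^sub>m 1\<^sub>m n) * V = V * (c \<cdot>\<^sub>m 1\<^sub>m n)"
    using V by (simp add: mult_smult_assoc_mat[of _ n n _ n] mult_smult_distrib[of _ n n _ n])
  also have "V * (c \<cdot>\<^sub>m 1\<^sub>m n) + (C * ?C) * V = V * horner_mat n (c # cs) B"
    unfolding step using B V by (simp add: mult_add_distrib_mat[of _ n n _ n])
  finally show ?case .
qed

lemma mult_mat_index:
  assumes "A \<in> carrier_mat n n" and "B \<in> carrier_mat n n" and "i < n" and "j < n"
  shows "(A * B) $$ (i, j) = (\<Sum>k<n. A $$ (i, k) * B $$ (k, j))"
  using assms by (simp add: scalar_prod_def atLeast0LessThan)

lemma horner_mat_Cons_index:
  assumes "A \<in> carrier_mat n n" and "i < n" and "j < n"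
  shows "horner_mat n (c # cs) A $$ (i, j)
    = (if i = j then c else 0) + (A * horner_mat n cs A) $$ (i, j)"
  using assms horner_mat_carrier[OF assms(1), of cs]
  by (simp del: index_mult_mat(1) horner_mat_carrier add: carrier_matD[of _ n n])

lemma (in unital_subring) horner_mat_closed:
  assumes A: "A \<in> carrier_mat n n" and "\<And>i j. i < n \<Longrightarrow> j < n \<Longrightarrow> A $$ (i, j) \<in> S"
    and "set cs \<subseteq> S" and "i < n" and "j < n"
  shows "horner_mat n cs A $$ (i, j) \<in> S"
  using assms(3-5)
proof (induction cs arbitrary: i j)
  case Nil
  then show ?case
    by (simp add: zero_closed)
next
  case (Cons c cs)
  have "(A * horner_mat n cs A) $$ (i, j) \<in> S"
    using Cons assms(2) A
    by (auto simp: mult_mat_index[of _ n] simp del: index_mult_mat intro!: sum_closed mult_closed)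
  then show ?case
    using Cons.prems A
    by (auto simp del: horner_mat.simps index_mult_mat simp: horner_mat_Cons_index intro: add_closed)
qed

text \<open>Lower triangular matrices are closed under products, and their diagonals multiply
  entrywise. The diagonal claim rests on the vanishing above it, hence the joint induction.\<close>

lemma horner_mat_lower_triangular:
  assumes B: "B \<in> carrier_mat n n" and lower: "\<And>i j. i < j \<Longrightarrow> j < n \<Longrightarrow> B $$ (i, j) = 0"
  shows "(i < j \<longrightarrow> j < n \<longrightarrow> horner_mat n cs B $$ (i, j) = 0) \<and>
    (i < n \<longrightarrow> horner_mat n cs B $$ (i, i) = horner_sum id (B $$ (i, i)) cs)"
proof (induction cs arbitrary: i j)
  case Nil
  then show ?case
    by simp
next
  case (Cons c cs)
  let ?H = "horner_mat n cs B"
  have zero: "(B * ?H) $$ (i, j) = 0" if "i < j" "j < n" for i j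
  proof -
    have "B $$ (i, k) * ?H $$ (k, j) = 0" if "k < n" for k
      using Cons.IH[of k j] lower[of i k] that \<open>i < j\<close> \<open>j < n\<close> by (cases "i < k") auto
    then show ?thesis
      using that B by (simp add: mult_mat_index[of _ n] del: index_mult_mat)
  qed
  have diag: "(B * ?H) $$ (i, i) = B $$ (i, i) * ?H $$ (i, i)" if "i < n" for i
  proof -
    have "(\<Sum>k<n. B $$ (i, k) * ?H $$ (k, i)) = (\<Sum>k\<in>{i}. B $$ (i, k) * ?H $$ (k, i))"
    proof (rule sum.mono_neutral_right)
      show "\<forall>k\<in>{..<n} - {i}. B $$ (i, k) * ?H $$ (k, i) = 0"
      proof
        fix k assume "k \<in> {..<n} - {i}"
        then show "B $$ (i, k) * ?H $$ (k, i) = 0"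
          using Cons.IH[of k i] lower[of i k] that by (cases "i < k") auto
      qed
    qed (use that in auto)
    then show ?thesis
      using that B by (simp add: mult_mat_index[of _ n] del: index_mult_mat)
  qed
  show ?case
    using zero[of i j] diag[of i] Cons.IH[of i i] B
    by (auto simp del: horner_mat.simps index_mult_mat simp: horner_mat_Cons_index)
qed

section \<open>The companion matrix in the Newton basis\<close>

definition newton_basis :: "(nat \<Rightarrow> 'a::comm_ring_1) \<Rightarrow> nat \<Rightarrow> 'a poly" where
  "newton_basis x j = (\<Prod>l<j. [:- x l, 1:])"

lemma newton_basis_Suc: "newton_basis x (Suc j) = pCons 0 (newton_basis x j) - smult (x j) (newton_basis x j)"
  by (simp add: newton_basis_def mult.commute)

lemma coeff_newton_basis:
  "coeff (newton_basis x j) j = 1 \<and> (\<forall>i>j. coeff (newton_basis x j) i = 0)"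
proof (induction j)
  case 0
  then show ?case
    by (simp add: newton_basis_def)
next
  case (Suc j)
  then show ?case
    by (auto simp: newton_basis_Suc coeff_pCons split: nat.split)
qed

text \<open>Only the last column depends on \<open>x\<close>, through coefficients that are signed
  elementary symmetric functions.\<close>

definition companion_mat :: "(nat \<Rightarrow> 'a::comm_ring_1) \<Rightarrow> nat \<Rightarrow> 'a mat" where
  "companion_mat x n = mat n n (\<lambda>(i, j). (if i = Suc j then 1 else 0) -
     (if Suc j = n then coeff (newton_basis x n) i else 0))"

definition newton_mat :: "(nat \<Rightarrow> 'a::comm_ring_1) \<Rightarrow> nat \<Rightarrow> 'a mat" where
  "newton_mat x n = mat n n (\<lambda>(i, j). coeff (newton_basis x j) i)"

text \<open>For the Newton basis N, t * N_j = x_j * N_j + N_(j+1), where N_n is 0 modulo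
  \<open>newton_basis x n\<close>.\<close>

definition bidiag_mat :: "(nat \<Rightarrow> 'a::comm_ring_1) \<Rightarrow> nat \<Rightarrow> 'a mat" where
  "bidiag_mat x n = mat n n (\<lambda>(i, j). (if i = j then x j else 0) + (if i = Suc j then 1 else 0))"

text \<open>Both sides describe multiplication by the variable modulo \<open>newton_basis x n\<close>, once in
  the monomial basis and once in the Newton basis.\<close>

lemma companion_newton: "companion_mat x n * newton_mat x n = newton_mat x n * bidiag_mat x n"
proof (rule eq_matI)
  fix i j assume "i < dim_row (newton_mat x n * bidiag_mat x n)"
    and "j < dim_col (newton_mat x n * bidiag_mat x n)"
  then have i: "i < n" and j: "j < n"
    by (simp_all add: newton_mat_def bidiag_mat_def)
  let ?c = "\<lambda>j i. coeff (newton_basis x j) i"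
  \<comment> \<open>Only the last basis element reaches degree \<open>n - 1\<close>, so the
    reduction by \<open>newton_basis x n\<close> affects only the last column.\<close>
  have top: "?c j (n - 1) = (if Suc j = n then 1 else 0)"
    using coeff_newton_basis[of x j] j by (cases "Suc j = n") auto
  have "(companion_mat x n * newton_mat x n) $$ (i, j)
      = (\<Sum>k<n. (if i = Suc k then ?c j k else 0) - (if k = n - 1 then ?c n i * ?c j k else 0))"
    using i j by (subst mult_mat_index[of _ n])
      (auto simp: companion_mat_def newton_mat_def algebra_simps intro!: sum.cong)
  also have "\<dots> = (\<Sum>k<n. if i = Suc k then ?c j k else 0) - ?c n i * ?c j (n - 1)"
    using i by (simp add: sum_subtractf)
  also have "(\<Sum>k<n. if i = Suc k then ?c j k else 0) = coeff (pCons 0 (newton_basis x j)) i"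
    using i by (cases i) (simp_all add: coeff_pCons)
  finally have l: "(companion_mat x n * newton_mat x n) $$ (i, j)
      = coeff (pCons 0 (newton_basis x j)) i - (if Suc j = n then ?c n i else 0)"
    using top by auto
  have "(newton_mat x n * bidiag_mat x n) $$ (i, j)
      = (\<Sum>k<n. (if k = j then x j * ?c j i else 0) + (if k = Suc j then ?c (Suc j) i else 0))"
    using i j by (subst mult_mat_index[of _ n])
      (auto simp: bidiag_mat_def newton_mat_def algebra_simps intro!: sum.cong)
  also have "\<dots> = x j * ?c j i + (if Suc j < n then ?c (Suc j) i else 0)"
    using j by (simp add: sum.distrib)
  finally have r: "(newton_mat x n * bidiag_mat x n) $$ (i, j)
      = x j * ?c j i + (if Suc j < n then ?c (Suc j) i else 0)" .
  show "(companion_mat x n * newton_mat x n) $$ (i, j) = (newton_mat x n * bidiag_mat x n) $$ (i, j)"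
    unfolding l r using j by (cases "Suc j = n") (auto simp: newton_basis_Suc)
qed (simp_all add: companion_mat_def newton_mat_def bidiag_mat_def)

text \<open>The unitriangular \<open>newton_mat x n\<close> has determinant 1, so passing to the
  bidiagonal matrix with diagonal \<open>x\<close> preserves the determinant; the \<open>x i\<close>
  may coincide.\<close>

lemma det_horner_companion:
  "det (horner_mat n cs (companion_mat x n)) = (\<Prod>i<n. horner_sum id (x i) cs)"
proof -
  let ?C = "companion_mat x n" and ?V = "newton_mat x n" and ?B = "bidiag_mat x n"
  have [simp]: "?C \<in> carrier_mat n n" "?V \<in> carrier_mat n n" "?B \<in> carrier_mat n n"
    by (simp_all add: companion_mat_def newton_mat_def bidiag_mat_def)
  have "upper_triangular ?V"
    unfolding upper_triangular_def newton_mat_def using coeff_newton_basis[of x] by auto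
  then have "det ?V = prod_list (diag_mat ?V)"
    by (rule det_upper_triangular[of _ n]) simp
  also have "\<dots> = 1"
    using coeff_newton_basis[of x] by (simp add: prod_list_diag_prod newton_mat_def)
  finally have V: "det ?V = 1" .
  have "det (horner_mat n cs ?C) * det ?V = det ?V * det (horner_mat n cs ?B)"
    by (simp flip: det_mult[of _ n] add: horner_mat_intertwine[OF _ _ _ companion_newton])
  then have "det (horner_mat n cs ?C) = det (horner_mat n cs ?B)"
    by (simp add: V)
  also have "\<dots> = prod_list (diag_mat (horner_mat n cs ?B))"
    by (rule det_lower_triangular[of n])
      (auto simp: bidiag_mat_def intro!: conjunct1[OF horner_mat_lower_triangular, rule_format])
  also have "\<dots> = (\<Prod>i<n. horner_sum id (x i) cs)"
  proof -
    have "horner_mat n cs ?B $$ (i, i) = horner_sum id (x i) cs" if "i < n" for i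
      using horner_mat_lower_triangular[of ?B n i i cs] that by (auto simp: bidiag_mat_def)
    moreover have "dim_row (horner_mat n cs ?B) = n"
      using horner_mat_carrier[of ?B n cs] by (metis \<open>?B \<in> _\<close> carrier_matD(1))
    ultimately show ?thesis
      by (simp add: prod_list_diag_prod atLeast0LessThan)
  qed
  finally show ?thesis .
qed

text \<open>The product is a determinant with entries in \<open>S\<close>, since the companion
  matrix involves \<open>x\<close> only through signed elementary symmetric functions.\<close>

lemma (in unital_subring) prod_horner_closed:
  assumes "\<And>k. k \<in> {1..n} \<Longrightarrow> elem_sym k {..<n} x \<in> S" and "set cs \<subseteq> S"
  shows "(\<Prod>i<n. horner_sum id (x i) cs) \<in> S"
proof -
  have "coeff (newton_basis x n) i \<in> S" if "i < n" for i
    unfolding newton_basis_def using that assms(1)[of "n - i"]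
    by (subst coeff_prod_linear) (auto intro!: mult_closed power_closed uminus_closed one_closed)
  then have "det (horner_mat n cs (companion_mat x n)) \<in> S"
    using assms(2)
    by (intro det_closed[of _ n] horner_mat_closed horner_mat_carrier)
      (auto simp: companion_mat_def intro!: diff_closed uminus_closed one_closed zero_closed)
  then show ?thesis
    by (simp only: det_horner_companion)
qed

subsection \<open>The integer polynomials of the product\<close>

lemma prod_linear_times:
  assumes "finite I" and "finite J"
  shows "(\<Prod>i\<in>I. \<Prod>j\<in>J. 1 + fps_const (x i * y j) * fps_X) $ k
    = elem_sym k (I \<times> J) (\<lambda>(i, j). x i * y j)"
proof -
  have "(\<Prod>i\<in>I. \<Prod>j\<in>J. 1 + fps_const (x i * y j) * fps_X)
      = (\<Prod>p\<in>I \<times> J. 1 + fps_const ((\<lambda>(i, j). x i * y j) p) * fps_X)"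
    by (simp add: prod.cartesian_product split_def)
  then show ?thesis
    using assms by (simp add: fps_nth_prod_linear)
qed

text \<open>Reading the product as a polynomial in \<open>fps_const x\<close> with power series
  coefficients prepares it for \<open>prod_horner_closed\<close>.\<close>

lemma prod_linear_eq_horner_sum:
  "(\<Prod>j\<in>{1..n}. 1 + fps_const (x * y j) * fps_X)
    = horner_sum id (fps_const x) (map (\<lambda>k. fps_const (elem_sym k {1..n} y) * fps_X ^ k) [0..<Suc n])"
proof (rule fps_ext)
  fix k
  have "horner_sum id (fps_const x) (map (\<lambda>k. fps_const (elem_sym k {1..n} y) * fps_X ^ k) [0..<Suc n])
      = (\<Sum>l<Suc n. fps_const (x ^ l * elem_sym l {1..n} y) * fps_X ^ l)"
    by (simp add: horner_sum_eq_sum fps_const_power flip: fps_const_mult del: upt_Suc fps_const_mult)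
      (simp add: mult_ac atLeast0LessThan cong: sum.cong)
  also have "\<dots> $ k = (\<Sum>l<Suc n. if k = l then x ^ l * elem_sym l {1..n} y else 0)"
    by (simp add: fps_sum_nth if_distrib cong: if_cong del: sum.lessThan_Suc)
  also have "\<dots> = elem_sym k {1..n} (\<lambda>j. x * y j)"
    by (auto simp: elem_sym_scale elem_sym_gt_card simp del: sum.lessThan_Suc)
  finally show "(\<Prod>j\<in>{1..n}. 1 + fps_const (x * y j) * fps_X) $ k
    = horner_sum id (fps_const x) (map (\<lambda>k. fps_const (elem_sym k {1..n} y) * fps_X ^ k) [0..<Suc n]) $ k"
    by (subst fps_nth_prod_linear) simp_all
qed

text \<open>Links zero-based matrix indices to one-based variables; comparing generating products
  avoids reindexing subsets.\<close>

lemma elem_sym_lessThan: "elem_sym k {..<n} (\<lambda>i. x (Suc i)) = elem_sym k {1..n} x"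
  by (subst (1 2) fps_nth_prod_linear[symmetric]) (simp_all add: prod.atLeast1_atMost_eq)

context unital_subring
begin

lemma fps_subring: "unital_subring {F. \<forall>k. F $ k \<in> S}"
  by unfold_locales
    (auto simp: fps_one_nth fps_mult_nth intro!: one_closed zero_closed diff_closed sum_closed mult_closed)

text \<open>Let G(t) be the product over j of 1 + t y_j X. The element is coefficient
  \<open>k\<close> of the product of all G(x_i). As G has coefficients in S[[X]],
  \<open>prod_horner_closed\<close> in the power series ring keeps that product in S[[X]].\<close>

lemma elem_sym_times_closed:
  assumes x: "\<And>k. k \<in> {1..n} \<Longrightarrow> elem_sym k {1..n} x \<in> S"
    and y: "\<And>k. k \<in> {1..n} \<Longrightarrow> elem_sym k {1..n} y \<in> S"
  shows "elem_sym k ({1..n} \<times> {1..n}) (\<lambda>(i, j). x i * y j) \<in> S"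
proof -
  interpret F: unital_subring "{F. \<forall>k. F $ k \<in> S}"
    by (rule fps_subring)
  interpret C: comm_ring_hom "fps_const :: 'a \<Rightarrow> 'a fps"
    by (rule fps_const_hom)
  let ?cs = "map (\<lambda>k. fps_const (elem_sym k {1..n} y) * fps_X ^ k) [0..<Suc n]"
  have "elem_sym k {1..n} y \<in> S" if "k < Suc n" for k
  proof (cases "k = 0")
    case True
    have "{S. S \<subseteq> {1..n} \<and> card S = 0} = {{}}"
      by (auto dest: finite_subset)
    then show ?thesis
      by (simp add: True elem_sym_def one_closed)
  qed (use y that in auto)
  then have cs: "set ?cs \<subseteq> {F. \<forall>k. F $ k \<in> S}"
    by (auto simp del: upt_Suc intro!: mult_closed one_closed zero_closed)
  have "elem_sym k {..<n} (\<lambda>i. fps_const (x (Suc i))) \<in> {F. \<forall>k. F $ k \<in> S}" if "k \<in> {1..n}" for k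
    using x[OF that] by (simp add: C.hom_elem_sym[symmetric] elem_sym_lessThan zero_closed)
  then have "(\<Prod>i<n. horner_sum id (fps_const (x (Suc i))) ?cs) \<in> {F. \<forall>k. F $ k \<in> S}"
    using cs by (rule F.prod_horner_closed)
  also have "(\<Prod>i<n. horner_sum id (fps_const (x (Suc i))) ?cs)
      = (\<Prod>i\<in>{1..n}. \<Prod>j\<in>{1..n}. 1 + fps_const (x i * y j) * fps_X)"
    unfolding prod_linear_eq_horner_sum by (simp only: prod.atLeast1_atMost_eq One_nat_def)
  finally have "(\<Prod>i\<in>{1..n}. \<Prod>j\<in>{1..n}. 1 + fps_const (x i * y j) * fps_X) $ k \<in> S"
    by simp
  then show ?thesis
    by (simp only: prod_linear_times finite_atLeastAtMost)
qed

end

text \<open>The values of admissible polynomials at the elementary symmetric functions form a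
  subring \<open>?S\<close> containing e_k(x) and e_k(y) for k from 1 to n; existence is membership
  of e_n(x_i y_j) in it.\<close>

lemma ene_poly_exists: "\<exists>Q. is_ene_poly n Q"
proof -
  let ?V = "Inl ` {1..n} \<union> Inr ` {1..n} :: (nat + nat) set"
  let ?h = "case_sum (\<lambda>k. elem_sym k {1..n} (\<lambda>i. Var (Inl i)))
                 (\<lambda>k. elem_sym k {1..n} (\<lambda>j. Var (Inr j))) :: nat + nat \<Rightarrow> (nat + nat) int_mpoly"
  interpret E: comm_ring_hom "eval_mpoly ?h"
    by (rule eval_mpoly_hom)
  let ?S = "eval_mpoly ?h ` {Q. indets Q \<subseteq> ?V}"
  interpret unital_subring ?S
  proof
    show "1 \<in> ?S"
      using E.hom_one by (intro image_eqI[of _ _ 1]) (simp_all add: indets_1)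
    fix a b assume "a \<in> ?S" "b \<in> ?S"
    then obtain p q where pq: "a = eval_mpoly ?h p" "b = eval_mpoly ?h q"
      "indets p \<subseteq> ?V" "indets q \<subseteq> ?V"
      by auto
    show "a - b \<in> ?S"
      using pq indets_diff[of p q] by (intro image_eqI[of _ _ "p - q"]) (blast intro: E.hom_minus[symmetric])+
    show "a * b \<in> ?S"
      using pq indets_mult[of p q] by (intro image_eqI[of _ _ "p * q"]) (blast intro: E.hom_mult[symmetric])+
  qed
  have "elem_sym k {1..n} (\<lambda>i. Var (Inl i)) \<in> ?S" if "k \<in> {1..n}" for k
    using that by (intro image_eqI[of _ _ "Var (Inl k)"]) (auto simp: indets_Var)
  moreover have "elem_sym k {1..n} (\<lambda>i. Var (Inr i)) \<in> ?S" if "k \<in> {1..n}" for k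
    using that by (intro image_eqI[of _ _ "Var (Inr k)"]) (auto simp: indets_Var)
  ultimately have "elem_sym n ({1..n} \<times> {1..n}) (\<lambda>(i, j). Var (Inl i) * Var (Inr j)) \<in> ?S"
    by (rule elem_sym_times_closed)
  then show ?thesis
    unfolding is_ene_poly_def by (smt (verit) image_iff mem_Collect_eq)
qed

section \<open>Specialising the integer polynomials, and their uniqueness\<close>

lemma poly_eq_prod_linear:
  fixes p :: "complex poly"
  assumes "coeff p 0 = 1" and "degree p \<le> n"
  shows "\<exists>x. p = (\<Prod>i\<in>{1..n}. [:1, x i:])"
  using assms
proof (induction n arbitrary: p)
  case 0
  then have "p = 1"
    by (auto elim!: degree_eq_zeroE simp: one_pCons)
  then show ?case
    by simp
next
  case (Suc n)
  obtain q c where q: "p = q * [:1, c:]" "degree q \<le> n"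
  proof (cases "degree p = 0")
    case True
    then show ?thesis
      using that[of p 0] by simp
  next
    case False
    then have "\<exists>z. poly p z = 0"
      using constant_degree[of p] fundamental_theorem_of_algebra[of p] by simp
    then obtain z q where q: "p = [:- z, 1:] * q"
      by (auto simp: poly_eq_0_iff_dvd elim!: dvdE)
    then have "z \<noteq> 0"
      using Suc.prems(1) by auto
    moreover have "q \<noteq> 0"
      using q False by auto
    then have "degree p = Suc (degree q)"
      unfolding q by (subst degree_mult_eq) auto
    \<comment> \<open>The nonzero root allows X - z = -z (1 - X/z); the constant -z goes to the
      cofactor.\<close>
    ultimately have "degree q \<le> n" "p = smult (- z) q * [:1, - 1 / z:]"
      using Suc.prems(2) by (simp_all add: q)
    then show ?thesis
      using that[of "smult (- z) q" "- 1 / z"] by simp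
  qed
  then have "coeff q 0 = 1"
    using Suc.prems(1) by simp
  then obtain x where x: "q = (\<Prod>i\<in>{1..n}. [:1, x i:])"
    using Suc.IH[OF _ q(2)] by blast
  have "(\<Prod>i\<in>{1..n}. [:1, (x(Suc n := c)) i:]) = q"
    unfolding x by (intro prod.cong) auto
  then have "p = (\<Prod>i\<in>{1..Suc n}. [:1, (x(Suc n := c)) i:])"
    using q(1) by simp
  then show ?case
    by blast
qed

text \<open>The polynomial 1 + a_1 X + ... + a_n X^n splits over the complex numbers into factors 1
  + x_i X, so its coefficients are the e_k(x).\<close>

lemma elem_sym_surj:
  fixes a :: "nat \<Rightarrow> complex"
  obtains x where "\<And>k. k \<in> {1..n} \<Longrightarrow> elem_sym k {1..n} x = a k"
proof -
  define p where "p = (\<Sum>k\<le>n. monom (if k = 0 then 1 else a k) k)"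
  have coeff_p: "coeff p k = (if k = 0 then 1 else if k \<le> n then a k else 0)" for k
    by (simp add: p_def coeff_sum)
  then have "degree p \<le> n"
    by (intro degree_le) auto
  then obtain x where x: "p = (\<Prod>i\<in>{1..n}. [:1, x i:])"
    using poly_eq_prod_linear[of p n] by (auto simp: coeff_p)
  have "elem_sym k {1..n} x = a k" if "k \<in> {1..n}" for k
  proof -
    have "fps_of_poly p = (\<Prod>i\<in>{1..n}. 1 + fps_const (x i) * fps_X)"
      by (simp add: x fps_of_poly_prod fps_of_poly_pCons mult.commute)
    then have "elem_sym k {1..n} x = coeff p k"
      by (simp add: fps_nth_prod_linear flip: fps_of_poly_nth)
    also have "\<dots> = a k"
      using that by (simp add: coeff_p)
    finally show ?thesis .
  qed
  then show ?thesis
    by (rule that)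
qed

text \<open>The defining identity holds between variables, so evaluation homomorphisms transport it;
  the bound on \<open>indets Q\<close> confines the hypotheses to indices 1 to n.\<close>

lemma eval_is_ene_poly:
  assumes Q: "is_ene_poly n Q"
    and a: "\<And>k. k \<in> {1..n} \<Longrightarrow> a k = elem_sym k {1..n} x"
    and b: "\<And>k. k \<in> {1..n} \<Longrightarrow> b k = elem_sym k {1..n} y"
  shows "eval_mpoly (case_sum a b) Q = elem_sym n ({1..n} \<times> {1..n}) (\<lambda>(i, j). x i * y j)"
proof -
  let ?h = "case_sum (\<lambda>k. elem_sym k {1..n} (\<lambda>i. Var (Inl i)))
                 (\<lambda>k. elem_sym k {1..n} (\<lambda>j. Var (Inr j))) :: nat + nat \<Rightarrow> (nat + nat) int_mpoly"
  interpret E: comm_ring_hom "eval_mpoly (case_sum x y)"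
    by (rule eval_mpoly_hom)
  have "eval_mpoly (case_sum a b) Q = eval_mpoly (\<lambda>v. eval_mpoly (case_sum x y) (?h v)) Q"
  proof (rule eval_mpoly_cong)
    fix v assume "v \<in> indets Q"
    then have "v \<in> Inl ` {1..n} \<union> Inr ` {1..n}"
      using Q unfolding is_ene_poly_def by blast
    then show "case_sum a b v = eval_mpoly (case_sum x y) (?h v)"
      using a b by (auto simp: E.hom_elem_sym)
  qed
  also have "\<dots> = eval_mpoly (case_sum x y) (eval_mpoly ?h Q)"
    by (rule E.hom_eval_mpoly[symmetric])
  also have "eval_mpoly ?h Q = elem_sym n ({1..n} \<times> {1..n}) (\<lambda>(i, j). Var (Inl i) * Var (Inr j))"
    using Q unfolding is_ene_poly_def by blast
  also have "eval_mpoly (case_sum x y) \<dots> = elem_sym n ({1..n} \<times> {1..n}) (\<lambda>(i, j). x i * y j)"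
    by (simp add: E.hom_elem_sym E.hom_mult split_def)
  finally show ?thesis .
qed

lemma is_ene_poly_unique:
  assumes "is_ene_poly n Q" and "is_ene_poly n Q'"
  shows "Q = Q'"
proof (rule int_mpoly_eqI)
  fix h :: "nat + nat \<Rightarrow> complex"
  obtain x where x: "\<And>k. k \<in> {1..n} \<Longrightarrow> elem_sym k {1..n} x = (h \<circ> Inl) k"
    using elem_sym_surj by blast
  obtain y where y: "\<And>k. k \<in> {1..n} \<Longrightarrow> elem_sym k {1..n} y = (h \<circ> Inr) k"
    using elem_sym_surj by blast
  have "h = case_sum (h \<circ> Inl) (h \<circ> Inr)"
    by (simp add: fun_eq_iff split: sum.split)
  then show "eval_mpoly h Q = eval_mpoly h Q'"
    using eval_is_ene_poly[OF assms(1) x[symmetric] y[symmetric]]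
      eval_is_ene_poly[OF assms(2) x[symmetric] y[symmetric]] by metis
qed

lemma is_ene_poly_ene_poly: "is_ene_poly n (ene_poly n)"
  unfolding ene_poly_def using ene_poly_exists is_ene_poly_unique by (metis theI)

lemma ene_prod_nth_elem_sym:
  assumes "n > 0"
    and "\<And>k. k \<in> {1..n} \<Longrightarrow> f $ k = elem_sym k {1..n} x"
    and "\<And>k. k \<in> {1..n} \<Longrightarrow> g $ k = elem_sym k {1..n} y"
  shows "(f \<star> g) $ n = (- 1) ^ n * elem_sym n ({1..n} \<times> {1..n}) (\<lambda>(i, j). x i * y j)"
  using assms(1) eval_is_ene_poly[OF is_ene_poly_ene_poly assms(2,3)]
  by (simp add: ene_prod_def)

subsection \<open>Logarithmic derivatives\<close>

text \<open>As \<open>f\<close> is invertible, this equation characterises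
  \<open>log_deriv f\<close> and can be checked instead of computing the inverse.\<close>

lemma log_deriv_unique:
  assumes "f $ 0 = 1" and "u * f = fps_deriv f"
  shows "log_deriv f = u"
proof -
  have "f * fps_right_inverse f 1 = 1"
    using assms(1) by (intro fps_right_inverse) simp
  then show ?thesis
    unfolding log_deriv_def assms(2)[symmetric] by (simp add: mult.assoc)
qed

lemma log_deriv_times:
  assumes "f $ 0 = 1" and "g $ 0 = 1"
  shows "log_deriv (f * g) = log_deriv f + log_deriv g"
proof (rule log_deriv_unique)
  have "(log_deriv f + log_deriv g) * (f * g)
      = (log_deriv f * f) * g + f * (log_deriv g * g)"
    by (simp add: algebra_simps)
  then show "(log_deriv f + log_deriv g) * (f * g) = fps_deriv (f * g)"
    using assms by (simp add: log_deriv_mult add.commute)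
qed (simp add: assms)

text \<open>The constant term joins the induction because \<open>log_deriv_times\<close> requires it
  of the partial product.\<close>

lemma log_deriv_prod:
  assumes "\<And>i. i \<in> I \<Longrightarrow> f i $ 0 = 1"
  shows "log_deriv (\<Prod>i\<in>I. f i) = (\<Sum>i\<in>I. log_deriv (f i)) \<and> (\<Prod>i\<in>I. f i) $ 0 = 1"
  using assms
proof (induction I rule: infinite_finite_induct)
  case (insert i I)
  then show ?case
    by (simp add: log_deriv_times)
qed (simp_all add: log_deriv_def)

lemma log_deriv_linear: "log_deriv (1 + fps_const z * fps_X) = Abs_fps (\<lambda>n. z * (- z) ^ n)"
proof (rule log_deriv_unique)
  show "Abs_fps (\<lambda>n. z * (- z) ^ n) * (1 + fps_const z * fps_X)
    = fps_deriv (1 + fps_const z * fps_X)"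
  proof (rule fps_ext)
    fix n
    show "(Abs_fps (\<lambda>n. z * (- z) ^ n) * (1 + fps_const z * fps_X)) $ n
      = fps_deriv (1 + fps_const z * fps_X) $ n"
    proof (cases n)
      case (Suc m)
      then show ?thesis
        by (simp add: distrib_left mult.assoc[symmetric])
    qed (simp add: distrib_left)
  qed
qed simp

lemma log_deriv_prod_linear:
  "log_deriv (\<Prod>i\<in>I. 1 + fps_const (z i) * fps_X) $ n = (- 1) ^ n * (\<Sum>i\<in>I. z i ^ Suc n)"
proof -
  have "log_deriv (\<Prod>i\<in>I. 1 + fps_const (z i) * fps_X)
      = (\<Sum>i\<in>I. log_deriv (1 + fps_const (z i) * fps_X))"
    by (intro conjunct1[OF log_deriv_prod]) simp
  also have "\<dots> $ n = (\<Sum>i\<in>I. z i * (- z i) ^ n)"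
    by (simp only: log_deriv_linear fps_sum_nth fps_nth_Abs_fps)
  also have "\<dots> = (- 1) ^ n * (\<Sum>i\<in>I. z i ^ Suc n)"
    by (simp add: sum_distrib_left power_minus[of "z _"] mult_ac)
  finally show ?thesis .
qed

text \<open>Coefficient \<open>n\<close> of u f = f', with the term i = n split off. It can be
  solved for \<open>log_deriv f $ n\<close> or for \<open>f $ Suc n\<close>.\<close>

lemma log_deriv_recurrence:
  assumes "f $ 0 = 1"
  shows "of_nat (Suc n) * f $ Suc n = log_deriv f $ n + (\<Sum>i<n. log_deriv f $ i * f $ (n - i))"
proof -
  have "of_nat (Suc n) * f $ Suc n = (log_deriv f * f) $ n"
    using assms by (simp add: log_deriv_mult)
  also have "\<dots> = (\<Sum>i<Suc n. log_deriv f $ i * f $ (n - i))"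
    by (simp only: fps_mult_nth atLeast0AtMost lessThan_Suc_atMost)
  finally show ?thesis
    using assms by simp
qed

text \<open>The recurrence gives \<open>log_deriv f $ i\<close> from coefficients up to
  \<open>Suc i\<close>, whence the strict bound on \<open>i\<close>.\<close>

lemma log_deriv_nth_cong:
  assumes "f $ 0 = 1" and "g $ 0 = 1" and "\<And>j. j \<le> k \<Longrightarrow> f $ j = g $ j" and "i < k"
  shows "log_deriv f $ i = log_deriv g $ i"
  using \<open>i < k\<close>
proof (induction i rule: less_induct)
  case (less i)
  have "(\<Sum>l<i. log_deriv f $ l * f $ (i - l)) = (\<Sum>l<i. log_deriv g $ l * g $ (i - l))"
    using less assms(3) by (intro sum.cong) auto
  then show ?case
    using log_deriv_recurrence[OF assms(1), of i] log_deriv_recurrence[OF assms(2), of i]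
      assms(3)[of "Suc i"] less.prems by simp
qed

text \<open>The recurrence gives \<open>f $ Suc n\<close> after division by n + 1, possible in
  characteristic 0.\<close>

lemma nth_eq_of_log_deriv:
  fixes f g :: "'a::field_char_0 fps"
  assumes "f $ 0 = 1" and "g $ 0 = 1" and "\<And>i. i < k \<Longrightarrow> log_deriv f $ i = log_deriv g $ i"
    and "j \<le> k"
  shows "f $ j = g $ j"
  using \<open>j \<le> k\<close>
proof (induction j rule: less_induct)
  case (less j)
  show ?case
  proof (cases j)
    case 0
    then show ?thesis
      using assms by simp
  next
    case (Suc n)
    have "(\<Sum>i<n. log_deriv f $ i * f $ (n - i)) = (\<Sum>i<n. log_deriv g $ i * g $ (n - i))"
      using less assms(3) Suc by (intro sum.cong) auto
    then have "of_nat (Suc n) * f $ Suc n = of_nat (Suc n) * g $ Suc n"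
      unfolding log_deriv_recurrence[OF assms(1)] log_deriv_recurrence[OF assms(2)]
      using assms(3)[of n] less.prems Suc by simp
    then show ?thesis
      using of_nat_neq_0[of n, where 'a = 'a] by (simp add: Suc del: of_nat_Suc)
  qed
qed

text \<open>The exponential of the formal integral of \<open>w\<close> works; that integral has
  constant term 0, as the chain rule for composition requires.\<close>

lemma log_deriv_surj:
  fixes w :: "'a::field_char_0 fps"
  obtains h where "h $ 0 = 1" and "log_deriv h = w"
proof -
  let ?h = "fps_exp 1 oo fps_integral0 w"
  have "fps_deriv ?h = ?h * w"
    by (subst fps_compose_deriv) (simp_all add: fps_deriv_fps_integral)
  moreover have "?h $ 0 = 1"
    by simp
  ultimately have "log_deriv ?h = w"
    by (intro log_deriv_unique) (simp_all add: mult.commute)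
  then show ?thesis
    using that[of ?h] by simp
qed

subsection \<open>The formula over the complex numbers\<close>

lemma ene_prod_nth_0 [simp]: "(f \<star> g) $ 0 = 1"
  by (simp add: ene_prod_def)

lemma log_deriv_ene_prod_complex:
  fixes f g :: "complex fps"
  assumes "f $ 0 = 1" and "g $ 0 = 1"
  shows "log_deriv (f \<star> g) = - (log_deriv f \<odot> log_deriv g)"
proof -
  obtain h :: "complex fps" where h: "h $ 0 = 1" "log_deriv h = - (log_deriv f \<odot> log_deriv g)"
    by (rule log_deriv_surj)
  have "f \<star> g = h"
  proof (rule fps_ext)
    fix k
    show "(f \<star> g) $ k = h $ k"
    proof (cases "k = 0")
      case False
      \<comment> \<open>The families depend on \<open>k\<close>; the products built from them match
        \<open>f\<close> and \<open>g\<close> up to degree \<open>k\<close>.\<close>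
      obtain x where x: "\<And>j. j \<in> {1..k} \<Longrightarrow> elem_sym j {1..k} x = f $ j"
        using elem_sym_surj[of k "fps_nth f"] by blast
      obtain y where y: "\<And>j. j \<in> {1..k} \<Longrightarrow> elem_sym j {1..k} y = g $ j"
        using elem_sym_surj[of k "fps_nth g"] by blast
      let ?L = "\<lambda>x. \<Prod>i\<in>{1..k}. 1 + fps_const (x i) * fps_X :: complex fps"
      \<comment> \<open>The factor \<open>- 1\<close> accounts for the sign \<open>(- 1) ^ k\<close>
        in \<open>f \<star> g\<close>, which is compared with \<open>?H\<close> at coefficient
        \<open>k\<close> only.\<close>
      let ?H = "\<Prod>p\<in>{1..k} \<times> {1..k}. 1 + fps_const (- 1 * (\<lambda>(i, j). x i * y j) p) * fps_X :: complex fps"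
      have L0: "?L x $ 0 = 1" for x
        by (intro conjunct2[OF log_deriv_prod]) simp
      have H0: "?H $ 0 = 1"
        by (intro conjunct2[OF log_deriv_prod]) simp
      have agree: "?L z $ j = u $ j"
        if "u $ 0 = 1" "\<And>j. j \<in> {1..k} \<Longrightarrow> elem_sym j {1..k} z = u $ j" "j \<le> k" for z u j
        using that L0[of z] by (cases "j = 0") (simp_all add: fps_nth_prod_linear)
      have "log_deriv ?H $ i = log_deriv h $ i" if "i < k" for i
      proof -
        have sign: "(- 1) ^ i * ((- 1) ^ i * c) = c" for c :: complex
          by (simp flip: mult.assoc power_mult_distrib)
        have sign2: "((- 1) ^ i * b) * ((- 1) ^ i * c) = b * c" for b c :: complex
          using sign[of "b * c"] by (simp only: mult_ac)
        have "log_deriv ?H $ i = - (\<Sum>p\<in>{1..k} \<times> {1..k}. (\<lambda>(i, j). x i * y j) p ^ Suc i)"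
          by (simp only: log_deriv_prod_linear power_mult_distrib[of "- 1"] sum_distrib_left[symmetric])
            (simp add: sign)
        \<comment> \<open>A power sum of the products x_i y_j is a product of two power sums; this
          is the source of the Hadamard product.\<close>
        also have "\<dots> = - ((\<Sum>i'\<in>{1..k}. x i' ^ Suc i) * (\<Sum>j\<in>{1..k}. y j ^ Suc i))"
          by (simp only: sum_product sum.cartesian_product split_def power_mult_distrib)
        also have "\<dots> = - (log_deriv (?L x) $ i * log_deriv (?L y) $ i)"
          by (simp only: log_deriv_prod_linear sign2)
        also have "log_deriv (?L x) $ i = log_deriv f $ i"
          using L0 assms(1) agree[of f x] x that by (intro log_deriv_nth_cong[of _ _ k]) auto
        also have "log_deriv (?L y) $ i = log_deriv g $ i"
          using L0 assms(2) agree[of g y] y that by (intro log_deriv_nth_cong[of _ _ k]) auto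
        finally show ?thesis
          by (simp add: h(2) hadamard_def)
      qed
      then have "?H $ k = h $ k"
        using nth_eq_of_log_deriv[OF H0 h(1), of k k] by simp
      moreover have "?H $ k = (- 1) ^ k * elem_sym k ({1..k} \<times> {1..k}) (\<lambda>(i, j). x i * y j)"
        by (subst fps_nth_prod_linear) (simp, rule elem_sym_scale)
      ultimately show ?thesis
        using False ene_prod_nth_elem_sym[of k f x g y] x y by simp
    qed (simp add: h)
  qed
  then show ?thesis
    by (simp add: h)
qed

subsection \<open>Transfer along ring homomorphisms\<close>

context comm_ring_hom
begin

definition map_fps :: "'a fps \<Rightarrow> 'b fps" where
  "map_fps f = Abs_fps (\<lambda>n. hom (f $ n))"

lemma map_fps_nth [simp]: "map_fps f $ n = hom (f $ n)"
  by (simp add: map_fps_def)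

text \<open>The image satisfies the equation characterising the logarithmic derivative of
  \<open>map_fps f\<close>.\<close>

lemma map_fps_log_deriv:
  assumes "f $ 0 = 1"
  shows "map_fps (log_deriv f) = log_deriv (map_fps f)"
proof (rule log_deriv_unique[symmetric])
  have "map_fps (log_deriv f) * map_fps f = map_fps (log_deriv f * f)"
    by (rule fps_ext) (simp add: fps_mult_nth hom_distribs)
  also have "\<dots> = map_fps (fps_deriv f)"
    using assms by (simp add: log_deriv_mult)
  also have "\<dots> = fps_deriv (map_fps f)"
    by (rule fps_ext) (simp add: hom_distribs)
  finally show "map_fps (log_deriv f) * map_fps f = fps_deriv (map_fps f)" .
qed (simp add: assms)

text \<open>The same integer polynomial \<open>ene_poly n\<close> serves both rings, and
  \<open>hom\<close> commutes with its evaluation.\<close>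

lemma map_fps_ene_prod: "map_fps (f \<star> g) = map_fps f \<star> map_fps g"
proof (rule fps_ext)
  fix n
  have "(\<lambda>v. hom (case_sum (fps_nth f) (fps_nth g) v))
      = case_sum (fps_nth (map_fps f)) (fps_nth (map_fps g))"
    by (auto simp: fun_eq_iff split: sum.split)
  then show "map_fps (f \<star> g) $ n = (map_fps f \<star> map_fps g) $ n"
    by (simp add: ene_prod_def hom_distribs hom_eval_mpoly)
qed

lemma map_fps_hadamard: "map_fps (- (f \<odot> g)) = - (map_fps f \<odot> map_fps g)"
  by (rule fps_ext) (simp add: hadamard_def hom_distribs)

end

theorem theorem10p6:
  fixes f g :: "'a::comm_ring_1 fps"
  assumes "fps_nth f 0 = 1" and "fps_nth g 0 = 1"
  shows "log_deriv (f \<star> g) = - (log_deriv f \<odot> log_deriv g)"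
proof -
  \<comment> \<open>The universal pair: all nonconstant coefficients are independent
    variables.\<close>
  define F G :: "(nat + nat) int_mpoly fps"
    where "F = Abs_fps (\<lambda>n. if n = 0 then 1 else Var (Inl n))"
      and "G = Abs_fps (\<lambda>n. if n = 0 then 1 else Var (Inr n))"
  have F0: "F $ 0 = 1" and G0: "G $ 0 = 1"
    by (simp_all add: F_def G_def)
  \<comment> \<open>The coefficients of both sides are integer polynomials, which complex
    assignments separate; each assignment leads to the complex case.\<close>
  have universal: "log_deriv (F \<star> G) = - (log_deriv F \<odot> log_deriv G)"
  proof (intro fps_ext int_mpoly_eqI)
    fix n and h :: "nat + nat \<Rightarrow> complex"
    interpret E: comm_ring_hom "eval_mpoly h"
      by (rule eval_mpoly_hom)
    have "E.map_fps (log_deriv (F \<star> G)) = E.map_fps (- (log_deriv F \<odot> log_deriv G))"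
      by (simp add: E.map_fps_log_deriv E.map_fps_ene_prod E.map_fps_hadamard F0 G0
          log_deriv_ene_prod_complex)
    then show "eval_mpoly h (log_deriv (F \<star> G) $ n) = eval_mpoly h ((- (log_deriv F \<odot> log_deriv G)) $ n)"
      by (metis E.map_fps_nth)
  qed
  \<comment> \<open>Sending the variables to the coefficients of \<open>f\<close> and
    \<open>g\<close> carries \<open>F\<close> to \<open>f\<close> and \<open>G\<close> to
    \<open>g\<close>; the constant terms agree by assumption.\<close>
  interpret E: comm_ring_hom "eval_mpoly (case_sum (fps_nth f) (fps_nth g))"
    by (rule eval_mpoly_hom)
  have "E.map_fps F = f" "E.map_fps G = g"
    using assms by (auto simp: fps_eq_iff F_def G_def eval_mpoly_1)
  then show ?thesis
    using arg_cong[OF universal, of E.map_fps]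
    by (simp add: E.map_fps_log_deriv E.map_fps_ene_prod E.map_fps_hadamard F0 G0)
qed

end
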